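(* Let $(\Omega,\mathcal F,P)$ be a probability space, and let $f_i:\Omega^{m_i}\to S_i$, $i\in I$, be a finite or countable family of measurable functions, where, for each $i\in I$, $m_i\in\mathbb N\cup\{\infty\}$ (with $\mathbb N=\{1,2,\dots\}$) and $S_i$ is a Borel space. Then the family $(f_i)_{i\in I}$ can be represented on $([0,1],\mathcal B,dx)$, the unit interval with its Borel $\sigma$-field $\mathcal B$ and Lebesgue measure $dx$. That is, there exist measurable functions $\tilde f_i:[0,1]^{m_i}\to S_i$, $i\in I$, such that if $X_1,X_2,\dots$ are i.i.d. random elements of $\Omega$ with distribution $P$, and $\tilde X_1,\tilde X_2,\dots$ are i.i.d. random variables uniformly distributed on $[0,1]$, then the collections $$\bigl\{f_i(X_{\sigma(1)},\dots,X_{\sigma(m_i)}): i\in I,\ \sigma\in\mathfrak S_\infty\bigr\}\quad\text{and}\quad\bigl\{\tilde f_i(\tilde X_{\sigma(1)},\dots,\tilde X_{\sigma(m_i)}): i\in I,\ \sigma\in\mathfrak S_\infty\bigr\},$$ both indexed by $(i,\sigma)\in I\times\mathfrak S_\infty$, have the same (joint) distribution. Moreover, if every $f_i$ is symmetric, then the representing functions $\tilde f_i$ on $[0,1]$ can be chosen to be symmetric too.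
   Context: A Borel space is a measurable space that is isomorphic (via a bijection measurable in both directions) to a Borel subset of $[0,1]$ with its Borel $\sigma$-field. $\mathfrak S_\infty$ denotes the set of all permutations (bijections) of $\mathbb N=\{1,2,\dots\}$. When $m=\infty$, $\Omega^{m}$ is the countably infinite product $\Omega^{\mathbb N}$, and $f(X_{\sigma(1)},\dots,X_{\sigma(m)})$ is interpreted as $f(X_{\sigma(1)},X_{\sigma(2)},\dots)$. Measurability convention: $\Omega^{m}$ may be equipped either with the product $\sigma$-field $\mathcal F^{m}$ or with its completion with respect to the product measure $P^{m}$; the choice does not matter, since a function measurable with respect to the completion can be modified on a null set to be $\mathcal F^{m}$-measurable without changing any of the distributions above. Similarly, the functions $\tilde f_i$ may be taken to be measurable with respect to the product $\sigma$-field $\mathcal B^{m_i}$. A function $f:\Omega^m\to S$ is symmetric if it is invariant under all permutations of its coordinates, i.e. $f(x_{\pi(1)},\dots,x_{\pi(m)})=f(x_1,\dots,x_m)$ for every $(x_1,\dots,x_m)\in\Omega^m$ and every permutation $\pi$ of $\{1,\dots,m\}$ (of $\mathbb N$ if $m=\infty$). Equality in distribution of two collections of random variables with the same index set means equality of their joint distributions, i.e. of the laws they induce on the product of the target spaces with the product $\sigma$-field (equivalently, equality of all finite-dimensional distributions). *)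

theory Defs
  imports "HOL-Probability.Probability" "HOL-Combinatorics.Permutations"
begin

text \<open>Only the space and the \<open>\<sigma>\<close>-field of \<open>S\<close> matter.\<close>

definition borel_isomorphic_space :: "'a measure \<Rightarrow> bool" where
  "borel_isomorphic_space S \<longleftrightarrow>
     (\<exists>B \<phi>. B \<in> sets (borel :: real measure) \<and> B \<subseteq> {0..1} \<and>
        bij_betw \<phi> (space S) B \<and>
        \<phi> \<in> S \<rightarrow>\<^sub>M restrict_space borel B \<and>
        the_inv_into (space S) \<phi> \<in> restrict_space borel B \<rightarrow>\<^sub>M S)"

definition unit_lebesgue :: "real measure" where
  "unit_lebesgue = restrict_space lborel {0..1}"

text \<open>Points of \<open>\<Omega>\<^sup>m\<close> are the extensional functions on \<open>coords m\<close>: \<open>{1..m}\<close> if \<open>m\<close> is finite and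
  \<open>{1..}\<close> if \<open>m = \<infinity>\<close>.\<close>

definition coords :: "enat \<Rightarrow> nat set" where
  "coords m = {k. 1 \<le> k \<and> enat k \<le> m}"

abbreviation power_measure :: "'a measure \<Rightarrow> enat \<Rightarrow> (nat \<Rightarrow> 'a) measure" where
  "power_measure P m \<equiv> Pi\<^sub>M (coords m) (\<lambda>_. P)"

definition symmetric_fun :: "'a measure \<Rightarrow> enat \<Rightarrow> ((nat \<Rightarrow> 'a) \<Rightarrow> 's) \<Rightarrow> bool" where
  "symmetric_fun P m f \<longleftrightarrow>
     (\<forall>x \<in> space (power_measure P m). \<forall>\<pi>. \<pi> permutes coords m \<longrightarrow>
        f (\<lambda>k\<in>coords m. x (\<pi> k)) = f x)"

text \<open>\<^const>\<open>permutes\<close> imposes no finiteness of the support.\<close>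

definition perms_inf :: "(nat \<Rightarrow> nat) set" where
  "perms_inf = {\<sigma>. \<sigma> permutes {1..}}"

definition iid_sequence :: "'w measure \<Rightarrow> 'a measure \<Rightarrow> (nat \<Rightarrow> 'w \<Rightarrow> 'a) \<Rightarrow> bool" where
  "iid_sequence M P X \<longleftrightarrow>
     prob_space M \<and> prob_space.indep_vars M (\<lambda>_. P) X {1..} \<and>
     (\<forall>k\<ge>1. distr M P (X k) = P)"

text \<open>The joint law of the variables \<open>f\<^sub>i (X\<^bsub>\<sigma>(1)\<^esub>, X\<^bsub>\<sigma>(2)\<^esub>, \<dots>)\<close>, indexed by \<open>(i, \<sigma>)\<close>. If the \<open>f i\<close>
  are only measurable for the completed product \<open>\<sigma>\<close>-field, these are random variables on the completion
  of \<open>M\<close>; if they are measurable for the product \<open>\<sigma>\<close>-field itself, the completion does not change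
  the law (fact \<open>distr_completion\<close>).\<close>

definition joint_law ::
  "'i set \<Rightarrow> ('i \<Rightarrow> enat) \<Rightarrow> ('i \<Rightarrow> 's measure) \<Rightarrow> ('i \<Rightarrow> (nat \<Rightarrow> 'a) \<Rightarrow> 's) \<Rightarrow>
   'w measure \<Rightarrow> (nat \<Rightarrow> 'w \<Rightarrow> 'a) \<Rightarrow> ('i \<times> (nat \<Rightarrow> nat) \<Rightarrow> 's) measure" where
  "joint_law I m S f M X =
     distr (completion M) (Pi\<^sub>M (I \<times> perms_inf) (\<lambda>(i, \<sigma>). S i))
       (\<lambda>\<omega>. \<lambda>(i, \<sigma>)\<in>I \<times> perms_inf. f i (\<lambda>k\<in>coords (m i). X (\<sigma> k) \<omega>))"

text \<open>The joint law for the i.i.d. sequence of coordinate maps on \<open>\<Omega>\<^sup>\<infinity>\<close>. It involves no type of an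
  ambient probability space, so a representation stated with it does not depend on such a type.\<close>

abbreviation canonical_law ::
  "'i set \<Rightarrow> ('i \<Rightarrow> enat) \<Rightarrow> ('i \<Rightarrow> 's measure) \<Rightarrow> ('i \<Rightarrow> (nat \<Rightarrow> 'a) \<Rightarrow> 's) \<Rightarrow>
   'a measure \<Rightarrow> ('i \<times> (nat \<Rightarrow> nat) \<Rightarrow> 's) measure" where
  "canonical_law I m S f P \<equiv> joint_law I m S f (power_measure P \<infinity>) (\<lambda>k \<omega>. \<omega> k)"

end

theory Submission
  imports Defs
begin

text \<open>
  Why the representation exists. A set in a product \<open>\<sigma>\<close>-field involves only countably many sets of the
  factor \<open>\<sigma>\<close>-field, and a Borel space is a Borel part of the real line. So a countable family \<open>(f\<^sub>i)\<close>,
  after changes on null sets, sees a point of \<open>\<Omega>\<close> only through countably many sets \<open>A\<^sub>0, A\<^sub>1, \<dots>\<close>. The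
  indicators of these sets can be packed into the ternary digits of one measurable function
  \<open>\<phi> : \<Omega> \<rightarrow> \<real>\<close>, and then \<open>f\<^sub>i (x\<^sub>1, x\<^sub>2, \<dots>) = k\<^sub>i (\<phi> x\<^sub>1, \<phi> x\<^sub>2, \<dots>)\<close> almost everywhere
  (\<open>common_real_factor\<close>). Every distribution on the real line, in particular that of \<open>\<phi>\<close>, is the image of
  the uniform distribution under its quantile function \<open>\<psi>\<close> (\<open>ex_unit_lebesgue_pushforward\<close>), so that
  \<open>g\<^sub>i (t\<^sub>1, t\<^sub>2, \<dots>) = k\<^sub>i (\<psi> t\<^sub>1, \<psi> t\<^sub>2, \<dots>)\<close> represents \<open>f\<^sub>i\<close>. That both families have the joint law of
  the \<open>k\<^sub>i\<close> under the distribution of \<open>\<phi>\<close> is \<open>canonical_law_transport\<close>. Null sets are harmless although there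
  are uncountably many \<open>\<sigma>\<close>: the product \<open>\<sigma>\<close>-field on the index set \<open>I \<times> \<SS>\<^sub>\<infinity>\<close> is generated by finitely
  many coordinates at a time (\<open>distr_PiM_cong_AE\<close>).

  Symmetry. If \<open>f\<^sub>i\<close> is symmetric, a given permutation leaves \<open>k\<^sub>i\<close> a priori invariant only at almost
  every point of the form \<open>(\<phi> x\<^sub>1, \<phi> x\<^sub>2, \<dots>)\<close>. For finitely many coordinates the maximum over all
  permutations repairs this. For infinitely many coordinates there are uncountably many permutations,
  and the measurability of such a maximum is not clear;
  but then the Hewitt--Savage law (\<open>Hewitt_Savage\<close>) says that \<open>f\<^sub>i\<close> is almost everywhere constant, and a
  constant is symmetric.
\<close>

section \<open>Joint laws of permuted families\<close>

text \<open>A preimage of a null set is a null set, so a measure preserving map stays measurable between the completions.\<close>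

lemma measure_preserving_completion:
  assumes T: "T \<in> M \<rightarrow>\<^sub>M N" "distr M N T = N"
  shows "T \<in> completion M \<rightarrow>\<^sub>M completion N"
    and "distr (completion M) (completion N) T = completion N"
proof -
  have T': "T \<in> completion M \<rightarrow>\<^sub>M N" using T(1) by (rule measurable_completion)
  have d: "distr (completion M) N T = N"
    using T by (simp add: distr_completion)
  show "T \<in> completion M \<rightarrow>\<^sub>M completion N"
    using T' by (intro completion.measurable_completion2) (simp_all add: d)
  show "distr (completion M) (completion N) T = completion N"
    using completion.completion_distr_eq[OF T'] d by simp
qed

text \<open>The index set \<open>K\<close> may be uncountable, and \<open>F x = G x\<close> may then fail for every \<open>x\<close>. The laws agree
  nevertheless, because they are determined by the finite-dimensional cylinders, and each cylinder meets only
  finitely many of the exceptional null sets.\<close>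

lemma distr_PiM_cong_AE:
  assumes "prob_space M"
    and F: "F \<in> M \<rightarrow>\<^sub>M Pi\<^sub>M K S" and G: "G \<in> M \<rightarrow>\<^sub>M Pi\<^sub>M K S"
    and ae: "\<And>j. j \<in> K \<Longrightarrow> AE x in M. F x j = G x j"
  shows "distr M (Pi\<^sub>M K S) F = distr M (Pi\<^sub>M K S) G"
proof (rule measure_eqI_PiM_infinite)
  interpret prob_space M by fact
  show "finite_measure (distr M (Pi\<^sub>M K S) F)"
    using F by (intro prob_space.finite_measure prob_space_distr)
  fix A J assume J: "finite J" "J \<subseteq> K" and A: "\<And>i. i \<in> J \<Longrightarrow> A i \<in> sets (S i)"
  let ?E = "prod_emb K S J (Pi\<^sub>E J A)"
  have E: "?E \<in> sets (Pi\<^sub>M K S)" using J A by (intro sets_PiM_I) auto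
  have eq: "AE x in M. \<forall>j\<in>J. F x j = G x j"
    using J ae by (intro AE_finite_allI) auto
  have mem: "(x \<in> ?E) = (\<forall>j\<in>J. x j \<in> A j)" if "x \<in> space (Pi\<^sub>M K S)" for x
    using that J by (auto simp: prod_emb_def space_PiM PiE_iff restrict_def extensional_def)
  have "AE x in M. (F x \<in> ?E) = (G x \<in> ?E)"
    using eq AE_space
  proof eventually_elim
    case (elim x)
    then show ?case using measurable_space[OF F] measurable_space[OF G] by (simp add: mem)
  qed
  then have "emeasure M (F -` ?E \<inter> space M) = emeasure M (G -` ?E \<inter> space M)"
    using E F G by (intro emeasure_eq_AE) auto
  then show "emeasure (distr M (Pi\<^sub>M K S) F) ?E = emeasure (distr M (Pi\<^sub>M K S) G) ?E"
    using E F G by (simp add: emeasure_distr)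
qed simp_all

lemma coords_infinity: "coords \<infinity> = {1..}"
  by (auto simp: coords_def)

lemma coords_subset: "coords m \<subseteq> {1..}"
  by (auto simp: coords_def)

lemma perms_inf_coords:
  assumes "\<sigma> \<in> perms_inf"
  shows "inj_on \<sigma> (coords m)" "\<sigma> \<in> coords m \<rightarrow> coords \<infinity>"
  using assms permutes_in_image[of \<sigma> "{1..}"] coords_subset[of m]
  by (auto simp: perms_inf_def coords_infinity permutes_inj_on)

lemma prob_space_power: "prob_space P \<Longrightarrow> prob_space (power_measure P m)"
  by (intro prob_space_PiM)

text \<open>Distinct coordinates are read off, so they are again independent with law \<open>P\<close>. This covers permutations of the
  coordinates as well as the restriction to fewer of them.\<close>

lemma measure_preserving_reindex:
  assumes "prob_space P" "inj_on \<sigma> J" "\<sigma> \<in> J \<rightarrow> K"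
  shows "(\<lambda>\<omega>. \<lambda>k\<in>J. \<omega> (\<sigma> k)) \<in> Pi\<^sub>M K (\<lambda>_. P) \<rightarrow>\<^sub>M Pi\<^sub>M J (\<lambda>_. P)"
    and "distr (Pi\<^sub>M K (\<lambda>_. P)) (Pi\<^sub>M J (\<lambda>_. P)) (\<lambda>\<omega>. \<lambda>k\<in>J. \<omega> (\<sigma> k)) = Pi\<^sub>M J (\<lambda>_. P)"
  using distr_PiM_reindex[of K "\<lambda>_. P" \<sigma> J] assms
  by (auto intro!: measurable_restrict measurable_component_singleton)

text \<open>The map whose image measure is \<^const>\<open>canonical_law\<close>; every \<^const>\<open>joint_law\<close> arises by composing it with the
  underlying sequence, which separates the functions from the probability space.\<close>

definition joint_family ::
  "'i set \<Rightarrow> ('i \<Rightarrow> enat) \<Rightarrow> ('i \<Rightarrow> (nat \<Rightarrow> 'a) \<Rightarrow> 's) \<Rightarrow> (nat \<Rightarrow> 'a) \<Rightarrow> 'i \<times> (nat \<Rightarrow> nat) \<Rightarrow> 's" where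
  "joint_family I m f \<omega> = (\<lambda>(i, \<sigma>)\<in>I \<times> perms_inf. f i (\<lambda>k\<in>coords (m i). \<omega> (\<sigma> k)))"

lemma measurable_joint_family:
  assumes P: "prob_space P"
    and f: "\<And>i. i \<in> I \<Longrightarrow> f i \<in> completion (power_measure P (m i)) \<rightarrow>\<^sub>M S i"
  shows "joint_family I m f \<in> completion (power_measure P \<infinity>) \<rightarrow>\<^sub>M Pi\<^sub>M (I \<times> perms_inf) (\<lambda>(i, \<sigma>). S i)"
  unfolding joint_family_def
proof (rule measurable_restrict, clarify)
  fix i \<sigma> assume i: "i \<in> I" and \<sigma>: "\<sigma> \<in> perms_inf"
  show "(\<lambda>\<omega>. f i (\<lambda>k\<in>coords (m i). \<omega> (\<sigma> k))) \<in> completion (power_measure P \<infinity>) \<rightarrow>\<^sub>M S i"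
    using measure_preserving_completion(1)[OF measure_preserving_reindex[OF P perms_inf_coords[OF \<sigma>]]]
      f[OF i] by (rule measurable_compose)
qed

lemma canonical_law_eq:
  "canonical_law I m S f P =
    distr (completion (power_measure P \<infinity>)) (Pi\<^sub>M (I \<times> perms_inf) (\<lambda>(i, \<sigma>). S i)) (joint_family I m f)"
  by (simp add: joint_law_def joint_family_def[abs_def])

lemma iid_sequence_measure_preserving:
  assumes "iid_sequence M P X"
  shows "(\<lambda>\<omega>. \<lambda>k\<in>coords \<infinity>. X k \<omega>) \<in> M \<rightarrow>\<^sub>M power_measure P \<infinity>"
    and "distr M (power_measure P \<infinity>) (\<lambda>\<omega>. \<lambda>k\<in>coords \<infinity>. X k \<omega>) = power_measure P \<infinity>"
proof -
  interpret prob_space M using assms by (simp add: iid_sequence_def)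
  have ind: "indep_vars (\<lambda>_. P) X {1..}" and d: "\<And>k. k \<ge> 1 \<Longrightarrow> distr M P (X k) = P"
    using assms by (auto simp: iid_sequence_def)
  have X: "random_variable P (X k)" if "k \<in> {1..}" for k
    using ind that by (auto simp: indep_vars_def)
  then show "(\<lambda>\<omega>. \<lambda>k\<in>coords \<infinity>. X k \<omega>) \<in> M \<rightarrow>\<^sub>M power_measure P \<infinity>"
    by (intro measurable_restrict) (simp add: coords_infinity)
  have "distr M (Pi\<^sub>M {1..} (\<lambda>_. P)) (\<lambda>\<omega>. \<lambda>k\<in>{1..}. X k \<omega>) = Pi\<^sub>M {1..} (\<lambda>k. distr M P (X k))"
    by (rule indep_vars_iff_distr_eq_PiM'[THEN iffD1, OF _ _ ind]) (simp_all add: X)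
  also have "\<dots> = Pi\<^sub>M {1..} (\<lambda>_. P)" using d by (intro PiM_cong) auto
  finally show "distr M (power_measure P \<infinity>) (\<lambda>\<omega>. \<lambda>k\<in>coords \<infinity>. X k \<omega>) = power_measure P \<infinity>"
    by (simp add: coords_infinity)
qed

text \<open>An i.i.d. sequence is a measure preserving map into the infinite power, so the joint law does not depend on
  the probability space that carries the sequence.\<close>

lemma joint_law_eq_canonical_law:
  assumes X: "iid_sequence M P X" and P: "prob_space P"
    and f: "\<And>i. i \<in> I \<Longrightarrow> f i \<in> completion (power_measure P (m i)) \<rightarrow>\<^sub>M S i"
  shows "joint_law I m S f M X = canonical_law I m S f P"
proof -
  let ?Q = "completion (power_measure P \<infinity>)" and ?T = "\<lambda>\<omega>. \<lambda>k\<in>coords \<infinity>. X k \<omega>"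
  let ?N = "Pi\<^sub>M (I \<times> perms_inf) (\<lambda>(i, \<sigma>). S i)"
  note T = measure_preserving_completion[OF iid_sequence_measure_preserving[OF X]]
  have eq: "(\<lambda>k\<in>coords (m i). X (\<sigma> k) \<omega>) = (\<lambda>k\<in>coords (m i). ?T \<omega> (\<sigma> k))"
    if "\<sigma> \<in> perms_inf" for i \<sigma> \<omega>
    using perms_inf_coords(2)[OF that] by (auto simp: Pi_iff fun_eq_iff)
  have "joint_law I m S f M X = distr (completion M) ?N (joint_family I m f \<circ> ?T)"
    unfolding joint_law_def joint_family_def comp_def
    by (intro distr_cong refl restrict_ext) (simp only: eq split: prod.splits, clarsimp simp: eq)
  also have "\<dots> = distr (distr (completion M) ?Q ?T) ?N (joint_family I m f)"
    using measurable_joint_family[of P I f m S, OF P f] T(1) by (subst distr_distr) auto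
  also have "\<dots> = canonical_law I m S f P"
    by (simp add: T(2) canonical_law_eq)
  finally show ?thesis .
qed

lemma canonical_law_cong_AE:
  assumes P: "prob_space P"
    and f: "\<And>i. i \<in> I \<Longrightarrow> f i \<in> completion (power_measure P (m i)) \<rightarrow>\<^sub>M S i"
    and g: "\<And>i. i \<in> I \<Longrightarrow> g i \<in> completion (power_measure P (m i)) \<rightarrow>\<^sub>M S i"
    and ae: "\<And>i. i \<in> I \<Longrightarrow> AE x in power_measure P (m i). f i x = g i x"
  shows "canonical_law I m S f P = canonical_law I m S g P"
  unfolding canonical_law_eq
proof (rule distr_PiM_cong_AE)
  show "prob_space (completion (power_measure P \<infinity>))"
    using prob_space_power[OF P] by (simp add: prob_space.prob_space_completion)
  show "AE \<omega> in completion (power_measure P \<infinity>). joint_family I m f \<omega> j = joint_family I m g \<omega> j"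
    if "j \<in> I \<times> perms_inf" for j
  proof (cases j)
    case (Pair i \<sigma>)
    then have i: "i \<in> I" "\<sigma> \<in> perms_inf" using that by auto
    note T = measure_preserving_reindex[OF P perms_inf_coords[OF i(2), of "m i"]]
    have "AE x in distr (power_measure P \<infinity>) (power_measure P (m i)) (\<lambda>\<omega>. \<lambda>k\<in>coords (m i). \<omega> (\<sigma> k)). f i x = g i x"
      using ae[OF i(1)] T(2) by argo
    then have "AE \<omega> in power_measure P \<infinity>. f i (\<lambda>k\<in>coords (m i). \<omega> (\<sigma> k)) = g i (\<lambda>k\<in>coords (m i). \<omega> (\<sigma> k))"
      by (rule AE_distrD[OF T(1)])
    then show ?thesis using i by (intro AE_completion) (simp add: joint_family_def Pair)
  qed
qed (use measurable_joint_family[of P I _ m S, OF P] f g in auto)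

definition map_coords :: "nat set \<Rightarrow> ('a \<Rightarrow> 'b) \<Rightarrow> (nat \<Rightarrow> 'a) \<Rightarrow> nat \<Rightarrow> 'b" where
  "map_coords J \<phi> x = (\<lambda>k\<in>J. \<phi> (x k))"

lemma measurable_map_coords:
  "\<phi> \<in> P \<rightarrow>\<^sub>M R \<Longrightarrow> map_coords J \<phi> \<in> Pi\<^sub>M J (\<lambda>_. P) \<rightarrow>\<^sub>M Pi\<^sub>M J (\<lambda>_. R)"
  unfolding map_coords_def[abs_def]
  by (intro measurable_restrict) (auto intro: measurable_compose[OF measurable_component_singleton])

lemma map_coords_space:
  "x \<in> space (Pi\<^sub>M J (\<lambda>_. P)) \<Longrightarrow> \<phi> \<in> P \<rightarrow>\<^sub>M R \<Longrightarrow> map_coords J \<phi> x \<in> space (Pi\<^sub>M J (\<lambda>_. R))"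
  by (rule measurable_space[OF measurable_map_coords])

lemma iid_sequence_map_coords:
  assumes P: "prob_space P" and \<phi>: "\<phi> \<in> P \<rightarrow>\<^sub>M R"
  shows "iid_sequence (power_measure P \<infinity>) (distr P R \<phi>) (\<lambda>k \<omega>. \<phi> (\<omega> k))"
proof -
  interpret Q: prob_space "power_measure P \<infinity>" using P by (rule prob_space_power)
  have "distr (power_measure P \<infinity>) (power_measure P \<infinity>) (\<lambda>\<omega>. \<lambda>k\<in>coords \<infinity>. \<omega> k) = power_measure P \<infinity>"
    using measure_preserving_reindex(2)[OF P, of "\<lambda>k. k" "coords \<infinity>" "coords \<infinity>"] by simp
  also have "\<dots> = Pi\<^sub>M (coords \<infinity>) (\<lambda>k. distr (power_measure P \<infinity>) P (\<lambda>\<omega>. \<omega> k))"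
    using P by (intro PiM_cong refl distr_PiM_component[symmetric, where M="\<lambda>_. P"])
  finally have "Q.indep_vars (\<lambda>_. P) (\<lambda>k \<omega>. \<omega> k) (coords \<infinity>)"
    by (intro Q.indep_vars_iff_distr_eq_PiM'[THEN iffD2]) (simp_all add: coords_infinity)
  then have 1: "Q.indep_vars (\<lambda>_. distr P R \<phi>) (\<lambda>k \<omega>. \<phi> (\<omega> k)) {1..}"
    using Q.indep_vars_compose2[where Y="\<lambda>_. \<phi>" and N="\<lambda>_. distr P R \<phi>"] \<phi>
    by (simp add: coords_infinity)
  have "distr (power_measure P \<infinity>) (distr P R \<phi>) (\<lambda>\<omega>. \<phi> (\<omega> k)) = distr P R \<phi>" if "k \<ge> 1" for k
  proof -
    have k: "k \<in> coords \<infinity>" using that by (simp add: coords_infinity)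
    have "distr (power_measure P \<infinity>) (distr P R \<phi>) (\<lambda>\<omega>. \<phi> (\<omega> k)) = distr (power_measure P \<infinity>) R (\<phi> \<circ> (\<lambda>\<omega>. \<omega> k))"
      by (intro distr_cong) auto
    also have "\<dots> = distr (distr (power_measure P \<infinity>) P (\<lambda>\<omega>. \<omega> k)) R \<phi>"
      using \<phi> k by (intro distr_distr[symmetric]) auto
    also have "distr (power_measure P \<infinity>) P (\<lambda>\<omega>. \<omega> k) = P"
      using k P by (intro distr_PiM_component)
    finally show ?thesis .
  qed
  with 1 Q.prob_space_axioms show ?thesis by (simp add: iid_sequence_def)
qed

text \<open>The variables \<open>\<phi> (\<omega> k)\<close> are i.i.d. with the law of \<open>\<phi>\<close>, so the family \<open>h\<close> evaluated at them has the canonical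
  law of \<open>h\<close>. The theorem applies this twice with the same \<open>h\<close>: once to go down from \<open>\<Omega>\<close> to the real line and
  once to come back up to the unit interval.\<close>

lemma canonical_law_transport:
  assumes P: "prob_space P" and \<phi>: "\<phi> \<in> P \<rightarrow>\<^sub>M R"
    and f: "\<And>i. i \<in> I \<Longrightarrow> f i \<in> completion (power_measure P (m i)) \<rightarrow>\<^sub>M S i"
    and h: "\<And>i. i \<in> I \<Longrightarrow> h i \<in> power_measure R (m i) \<rightarrow>\<^sub>M S i"
    and ae: "\<And>i. i \<in> I \<Longrightarrow> AE x in power_measure P (m i). f i x = h i (map_coords (coords (m i)) \<phi> x)"
  shows "canonical_law I m S f P = canonical_law I m S h (distr P R \<phi>)"
proof -
  let ?g = "\<lambda>i x. h i (map_coords (coords (m i)) \<phi> x)"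
  have g: "?g i \<in> completion (power_measure P (m i)) \<rightarrow>\<^sub>M S i" if "i \<in> I" for i
    using measurable_compose[OF measurable_map_coords[OF \<phi>] h[OF that]]
    by (rule measurable_completion)
  have "sets (power_measure (distr P R \<phi>) (m i)) = sets (power_measure R (m i))" for i
    by (intro sets_PiM_cong) auto
  then have h': "h i \<in> completion (power_measure (distr P R \<phi>) (m i)) \<rightarrow>\<^sub>M S i" if "i \<in> I" for i
    using h[OF that] by (intro measurable_completion) (simp cong: measurable_cong_sets)
  have "canonical_law I m S f P = canonical_law I m S ?g P"
    using P f g ae by (rule canonical_law_cong_AE)
  also have "\<dots> = joint_law I m S h (power_measure P \<infinity>) (\<lambda>k \<omega>. \<phi> (\<omega> k))"
    unfolding joint_law_def
  proof (rule distr_cong[OF refl refl], intro restrict_ext, clarify)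
    fix \<omega> i and \<sigma> :: "nat \<Rightarrow> nat" assume "\<sigma> \<in> perms_inf"
    show "h i (map_coords (coords (m i)) \<phi> (\<lambda>k\<in>coords (m i). \<omega> (\<sigma> k))) = h i (\<lambda>k\<in>coords (m i). \<phi> (\<omega> (\<sigma> k)))"
      by (simp add: map_coords_def cong: restrict_cong)
  qed
  also have "\<dots> = canonical_law I m S h (distr P R \<phi>)"
    using iid_sequence_map_coords[OF P \<phi>] prob_space.prob_space_distr[OF P \<phi>] h'
    by (rule joint_law_eq_canonical_law)
  finally show ?thesis .
qed

section \<open>Coding countably many sets by the digits of a real number\<close>

text \<open>The points of the Cantor set: the gap between the two values of a digit exceeds what the later digits add up
  to, which makes the digits measurable functions of the value.\<close>

definition ternary_value :: "(nat \<Rightarrow> bool) \<Rightarrow> real" where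
  "ternary_value d = (\<Sum>n. 2 / 3 * (1 / 3) ^ n * of_bool (d n))"

lemma summable_ternary: "summable (\<lambda>n. 2 / 3 * (1 / 3) ^ n * of_bool (d n) :: real)"
  by (rule summable_comparison_test'[of "\<lambda>n. 2 / 3 * (1 / 3) ^ n" 0])
     (auto intro!: summable_mult summable_geometric)

lemma ternary_value_Suc:
  "ternary_value d = 2 / 3 * of_bool (d 0) + ternary_value (\<lambda>n. d (Suc n)) / 3"
proof -
  have "ternary_value d = (\<Sum>n. 2 / 3 * (1 / 3) ^ Suc n * of_bool (d (Suc n))) + 2 / 3 * of_bool (d 0)"
    unfolding ternary_value_def using suminf_split_head[OF summable_ternary[of d]] by simp
  also have "(\<Sum>n. 2 / 3 * (1 / 3) ^ Suc n * of_bool (d (Suc n)) :: real) =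
      (\<Sum>n. 1 / 3 * (2 / 3 * (1 / 3) ^ n * of_bool (d (Suc n))))"
    by (simp add: algebra_simps)
  also have "\<dots> = ternary_value (\<lambda>n. d (Suc n)) / 3"
    unfolding ternary_value_def using suminf_mult[OF summable_ternary[of "\<lambda>n. d (Suc n)"], of "1/3"] by simp
  finally show ?thesis by simp
qed

lemma ternary_value_bounds: "0 \<le> ternary_value d" "ternary_value d \<le> 1"
proof -
  show "0 \<le> ternary_value d"
    unfolding ternary_value_def by (intro suminf_nonneg summable_ternary) auto
  have "ternary_value d \<le> (\<Sum>n. 2 / 3 * (1 / 3) ^ n)"
    unfolding ternary_value_def
    by (intro suminf_le summable_ternary summable_mult summable_geometric) auto
  also have "\<dots> = 1"
    by (subst suminf_mult) (auto simp: suminf_geometric intro!: summable_geometric)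
  finally show "ternary_value d \<le> 1" .
qed

text \<open>On the Cantor set this map removes the first digit. The threshold can be any point
  strictly inside the gap from \<open>1/3\<close> to \<open>2/3\<close>.\<close>

definition ternary_shift :: "real \<Rightarrow> real" where
  "ternary_shift x = (if x < 1 / 2 then 3 * x else 3 * x - 2)"

lemma ternary_shift_funpow:
  "(ternary_shift ^^ n) (ternary_value d) = ternary_value (\<lambda>k. d (n + k))"
proof (induction n)
  case (Suc n)
  then show ?case
    using ternary_value_Suc[of "\<lambda>k. d (n + k)"] ternary_value_bounds[of "\<lambda>k. d (Suc (n + k))"]
    by (auto simp: ternary_shift_def split: if_splits)
qed simp

lemma ternary_digit: "d n \<longleftrightarrow> 1 / 2 \<le> (ternary_shift ^^ n) (ternary_value d)"
  using ternary_value_Suc[of "\<lambda>k. d (n + k)"] ternary_value_bounds[of "\<lambda>k. d (Suc (n + k))"]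
  by (auto simp: ternary_shift_funpow)

lemma measurable_ternary_shift_funpow: "ternary_shift ^^ n \<in> borel_measurable borel"
proof (induction n)
  case (Suc n)
  have "ternary_shift \<in> borel_measurable borel" unfolding ternary_shift_def by measurable
  with Suc show ?case by (simp add: measurable_comp)
qed (simp add: id_def)

text \<open>The function \<open>\<phi>\<close> separates everything that the sets in \<open>\<A>\<close> separate.\<close>

definition real_coded :: "'a measure \<Rightarrow> 'a set set \<Rightarrow> ('a \<Rightarrow> real) \<Rightarrow> bool" where
  "real_coded P \<A> \<phi> \<longleftrightarrow> \<phi> \<in> borel_measurable P \<and> (\<forall>A\<in>\<A>. \<exists>B\<in>sets borel. A = \<phi> -` B \<inter> space P)"

lemma real_coded_mono: "real_coded P \<A> \<phi> \<Longrightarrow> \<B> \<subseteq> \<A> \<Longrightarrow> real_coded P \<B> \<phi>"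
  by (auto simp: real_coded_def)

lemma countable_sets_real_coded:
  assumes A: "countable \<A>" "\<A> \<subseteq> sets P"
  obtains \<phi> where "real_coded P \<A> \<phi>"
proof -
  \<comment> \<open>The added empty set makes the family nonempty, hence enumerable.\<close>
  define a where "a = from_nat_into (insert {} \<A>)"
  have a: "a n \<in> sets P" for n
    using A(2) from_nat_into[of "insert {} \<A>" n] by (auto simp: a_def)
  define \<phi> where "\<phi> x = ternary_value (\<lambda>n. x \<in> a n)" for x
  show thesis
  proof (rule that, unfold real_coded_def, intro conjI ballI)
    show "\<phi> \<in> borel_measurable P"
      unfolding \<phi>_def ternary_value_def using a by measurable
    fix A assume "A \<in> \<A>"
    then obtain n where n: "A = a n"
      using A(1) from_nat_into_surj[of "insert {} \<A>" A] by (auto simp: a_def)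
    have "A = \<phi> -` ((ternary_shift ^^ n) -` {1 / 2..}) \<inter> space P"
      using sets.sets_into_space[OF a[of n]] ternary_digit[of "\<lambda>k. _ \<in> a k" n]
      by (auto simp: n \<phi>_def)
    moreover have "(ternary_shift ^^ n) -` {1 / 2..} \<in> sets borel"
      using measurable_sets[OF measurable_ternary_shift_funpow[of n], of "{1/2..}"] by simp
    ultimately show "\<exists>B\<in>sets borel. A = \<phi> -` B \<inter> space P" by blast
  qed
qed

section \<open>Factorization of functions on a power through real coordinates\<close>

text \<open>The set \<open>E\<close> depends only on the values of \<open>\<phi>\<close> at the coordinates. Membership in the generated \<open>\<sigma>\<close>-field is
  expressed by the witness \<open>H\<close> itself because \<open>H\<close> is the ingredient for the factor function.\<close>

definition is_pullback :: "'a measure \<Rightarrow> nat set \<Rightarrow> ('a \<Rightarrow> real) \<Rightarrow> (nat \<Rightarrow> 'a) set \<Rightarrow> (nat \<Rightarrow> real) set \<Rightarrow> bool" where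
  "is_pullback P J \<phi> E H \<longleftrightarrow> H \<in> sets (Pi\<^sub>M J (\<lambda>_. borel)) \<and>
     E = map_coords J \<phi> -` H \<inter> space (Pi\<^sub>M J (\<lambda>_. P))"

text \<open>The sets with this property form a \<open>\<sigma>\<close>-field: a countable union needs the union of countably many countable
  families, and enlarging \<open>\<A>\<close> only strengthens the requirement on \<open>\<phi>\<close>. That \<open>\<phi>\<close> is quantified after \<open>\<A>\<close>
  is what allows one \<open>\<phi>\<close> to serve many sets \<open>E\<close>.\<close>

lemma PiM_set_countably_generated:
  fixes P :: "'a measure"
  assumes "E \<in> sets (Pi\<^sub>M J (\<lambda>_. P))"
  shows "\<exists>\<A>. countable \<A> \<and> \<A> \<subseteq> sets P \<and> (\<forall>\<phi>. real_coded P \<A> \<phi> \<longrightarrow> (\<exists>H. is_pullback P J \<phi> E H))"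
  using assms[unfolded sets_PiM_single]
proof (induction rule: sigma_sets.induct)
  case (Basic E)
  then obtain i A where i: "i \<in> J" "A \<in> sets P" "E = {f \<in> \<Pi>\<^sub>E i\<in>J. space P. f i \<in> A}"
    by auto
  have "\<exists>H. is_pullback P J \<phi> E H" if "real_coded P {A} \<phi>" for \<phi>
  proof -
    from that obtain B where B: "B \<in> sets borel" "A = \<phi> -` B \<inter> space P" and \<phi>: "\<phi> \<in> borel_measurable P"
      by (auto simp: real_coded_def)
    have "E = map_coords J \<phi> -` {y \<in> space (Pi\<^sub>M J (\<lambda>_. borel)). y i \<in> B} \<inter> space (Pi\<^sub>M J (\<lambda>_. P))"
      using i(1) map_coords_space[OF _ \<phi>, of _ J]
      by (auto simp: i(3) B(2) map_coords_def space_PiM)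
    moreover have "{y \<in> space (Pi\<^sub>M J (\<lambda>_. borel)). y i \<in> B} \<in> sets (Pi\<^sub>M J (\<lambda>_. borel))"
      using i(1) B(1) by measurable
    ultimately show ?thesis by (auto simp: is_pullback_def)
  qed
  then show ?case using i(2) by (intro exI[of _ "{A}"]) auto
next
  case Empty
  show ?case by (intro exI[of _ "{}"]) (auto intro!: exI[of _ "{}"] simp: is_pullback_def)
next
  case (Compl E)
  have "\<exists>H. is_pullback P J \<phi> ((\<Pi>\<^sub>E i\<in>J. space P) - E) H"
    if "is_pullback P J \<phi> E H" and \<phi>: "\<phi> \<in> borel_measurable P" for \<phi> H
    using that map_coords_space[OF _ \<phi>, of _ J]
    by (intro exI[of _ "space (Pi\<^sub>M J (\<lambda>_. borel)) - H"]) (auto simp: is_pullback_def simp flip: space_PiM)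
  then show ?case using Compl.IH by (metis real_coded_def)
next
  case (Union E)
  then obtain \<A> where \<A>: "\<And>n. countable (\<A> n)" "\<And>n. \<A> n \<subseteq> sets P"
    and gen: "\<And>n \<phi>. real_coded P (\<A> n) \<phi> \<Longrightarrow> \<exists>H. is_pullback P J \<phi> (E n) H"
    by metis
  have "\<exists>H. is_pullback P J \<phi> (\<Union>n. E n) H" if \<phi>: "real_coded P (\<Union>n. \<A> n) \<phi>" for \<phi>
  proof -
    have "\<exists>H. is_pullback P J \<phi> (E n) H" for n
      using \<phi> by (intro gen) (auto intro: real_coded_mono)
    then obtain H where H: "\<And>n. is_pullback P J \<phi> (E n) (H n)" by metis
    then have "is_pullback P J \<phi> (\<Union>n. E n) (\<Union>n. H n)"
      unfolding is_pullback_def by blast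
    then show ?thesis by blast
  qed
  then show ?case using \<A> by (intro exI[of _ "\<Union>n. \<A> n"]) auto
qed

lemma countable_PiM_sets_common_factor:
  fixes P :: "'a measure"
  assumes "countable K" and E: "\<And>k. k \<in> K \<Longrightarrow> E k \<in> sets (Pi\<^sub>M (J k) (\<lambda>_. P))"
  obtains \<phi> H where "\<phi> \<in> borel_measurable P" "\<And>k. k \<in> K \<Longrightarrow> is_pullback P (J k) \<phi> (E k) (H k)"
proof -
  obtain \<A> where \<A>: "\<And>k. k \<in> K \<Longrightarrow> countable (\<A> k)" "\<And>k. k \<in> K \<Longrightarrow> \<A> k \<subseteq> sets P"
    and gen: "\<And>k \<phi>. k \<in> K \<Longrightarrow> real_coded P (\<A> k) \<phi> \<Longrightarrow> \<exists>H. is_pullback P (J k) \<phi> (E k) H"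
    using PiM_set_countably_generated[OF E] by metis
  have "countable (\<Union>k\<in>K. \<A> k)" "(\<Union>k\<in>K. \<A> k) \<subseteq> sets P"
    using \<A> \<open>countable K\<close> by auto
  then obtain \<phi> where \<phi>: "real_coded P (\<Union>k\<in>K. \<A> k) \<phi>"
    by (rule countable_sets_real_coded)
  have "\<exists>H. is_pullback P (J k) \<phi> (E k) H" if "k \<in> K" for k
    using that by (intro gen real_coded_mono[OF \<phi>]) auto
  then obtain H where "\<And>k. k \<in> K \<Longrightarrow> is_pullback P (J k) \<phi> (E k) (H k)" by metis
  then show thesis using \<phi> that by (auto simp: real_coded_def)
qed

lemma SUP_rat_less_eq:
  fixes a :: real
  assumes "0 \<le> a"
  shows "(SUP q::rat. ennreal (of_rat q) * indicator {q. of_rat q < a} q) = ennreal a"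
proof (rule antisym)
  show "(SUP q::rat. ennreal (of_rat q) * indicator {q. of_rat q < a} q) \<le> ennreal a"
    by (intro SUP_least) (auto simp: indicator_def intro: ennreal_leI)
  show "ennreal a \<le> (SUP q::rat. ennreal (of_rat q) * indicator {q. of_rat q < a} q)"
  proof (rule dense_le)
    fix y assume y: "y < ennreal a"
    then obtain r where r: "y = ennreal r" "0 \<le> r" by (cases y) auto
    with y assms obtain q :: rat where q: "r < of_rat q" "of_rat q < a"
      using of_rat_dense[of r a] by (auto simp: ennreal_less_iff)
    have "y \<le> ennreal (of_rat q) * indicator {q. of_rat q < a} q"
      using q r by (auto intro: ennreal_leI)
    also have "\<dots> \<le> (SUP q::rat. ennreal (of_rat q) * indicator {q. of_rat q < a} q)"
      by (rule SUP_upper) simp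
    finally show "y \<le> (SUP q::rat. ennreal (of_rat q) * indicator {q. of_rat q < a} q)" .
  qed
qed

text \<open>A nonnegative function is the supremum of \<open>q\<close> times the indicator of \<open>{u > q}\<close> over the rationals \<open>q\<close>. All
  these sets, for all \<open>i\<close>, are pullbacks under a common \<open>\<phi>\<close>; replacing each by the set it is pulled back from
  gives the factor function. Negative \<open>q\<close> contribute nothing, as \<^const>\<open>ennreal\<close> sends them to \<open>0\<close>.\<close>

lemma countable_functions_common_factor:
  fixes P :: "'a measure" and u :: "'i \<Rightarrow> (nat \<Rightarrow> 'a) \<Rightarrow> real"
  assumes "countable I"
    and u: "\<And>i. i \<in> I \<Longrightarrow> u i \<in> borel_measurable (Pi\<^sub>M (J i) (\<lambda>_. P))"
    and nonneg: "\<And>i x. i \<in> I \<Longrightarrow> 0 \<le> u i x"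
  obtains \<phi> :: "'a \<Rightarrow> real" and h :: "'i \<Rightarrow> (nat \<Rightarrow> real) \<Rightarrow> real" where "\<phi> \<in> borel_measurable P"
    "\<And>i. i \<in> I \<Longrightarrow> h i \<in> borel_measurable (Pi\<^sub>M (J i) (\<lambda>_. borel))"
    "\<And>i x. i \<in> I \<Longrightarrow> x \<in> space (Pi\<^sub>M (J i) (\<lambda>_. P)) \<Longrightarrow> u i x = h i (map_coords (J i) \<phi> x)"
proof -
  let ?E = "\<lambda>(i, q). {x \<in> space (Pi\<^sub>M (J i) (\<lambda>_. P)). real_of_rat q < u i x}"
  obtain \<phi> H where \<phi>: "\<phi> \<in> borel_measurable P"
    and H: "\<And>k. k \<in> I \<times> UNIV \<Longrightarrow> is_pullback P (J (fst k)) \<phi> (?E k) (H k)"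
  proof (rule countable_PiM_sets_common_factor[of "I \<times> UNIV" ?E "\<lambda>k. J (fst k)" P])
    show "?E k \<in> sets (Pi\<^sub>M (J (fst k)) (\<lambda>_. P))" if "k \<in> I \<times> UNIV" for k
    proof -
      obtain i q where k: "k = (i, q)" "i \<in> I" using \<open>k \<in> I \<times> UNIV\<close> by auto
      have [measurable]: "u i \<in> borel_measurable (Pi\<^sub>M (J i) (\<lambda>_. P))" using u k by simp
      show ?thesis by (simp add: k)
    qed
  qed (use \<open>countable I\<close> in auto)
  define h where "h i y = enn2real (SUP q::rat. ennreal (of_rat q) * indicator (H (i, q)) y)" for i y
  show thesis
  proof
    show "h i \<in> borel_measurable (Pi\<^sub>M (J i) (\<lambda>_. borel))" if "i \<in> I" for i
    proof -
      have [measurable]: "H (i, q) \<in> sets (Pi\<^sub>M (J i) (\<lambda>_. borel))" for q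
        using H[of "(i, q)"] that by (simp add: is_pullback_def)
      show ?thesis unfolding h_def by measurable
    qed
    show "u i x = h i (map_coords (J i) \<phi> x)" if "i \<in> I" "x \<in> space (Pi\<^sub>M (J i) (\<lambda>_. P))" for i x
    proof -
      have "map_coords (J i) \<phi> x \<in> H (i, q) \<longleftrightarrow> of_rat q < u i x" for q
        using H[of "(i, q)"] that by (auto simp: set_eq_iff is_pullback_def)
      then have "indicator (H (i, q)) (map_coords (J i) \<phi> x) = (indicator {q. of_rat q < u i x} q :: ennreal)" for q
        by (simp add: indicator_def)
      then show ?thesis using SUP_rat_less_eq[OF nonneg[OF that(1), of x]] nonneg[OF that(1), of x]
        by (simp add: h_def)
    qed
  qed (fact \<phi>)
qed

section \<open>The Hewitt--Savage zero-one law\<close>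

lemma (in prob_space) square_expectation_le:
  fixes Y :: "'a \<Rightarrow> real"
  assumes "integrable M Y" "integrable M (\<lambda>x. (Y x)\<^sup>2)"
  shows "(expectation Y)\<^sup>2 \<le> expectation (\<lambda>x. (Y x)\<^sup>2)"
  using variance_positive[of Y] variance_eq[OF assms] by simp

text \<open>A quantitative law of large numbers. The expectation of \<open>u\<close> against the centred indicator of \<open>D k\<close> is the same
  number \<open>b\<close> for all \<open>k\<close>, so \<open>K b\<close> is the expectation of \<open>u\<close> against a sum of \<open>K\<close> orthogonal variables. The
  second moment of that sum is at most \<open>K\<close>; hence \<open>K\<^sup>2 b\<^sup>2 \<le> K\<close> for all \<open>K\<close>, which forces \<open>b = 0\<close>.\<close>

lemma (in prob_space) expectation_product_pairwise_independent:
  fixes u :: "'a \<Rightarrow> real" and D :: "nat \<Rightarrow> 'a set"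
  assumes u: "u \<in> borel_measurable M" "\<And>x. 0 \<le> u x" "\<And>x. u x \<le> 1"
    and D: "\<And>k. D k \<in> events" "\<And>k. prob (D k) = p" "\<And>k l. k \<noteq> l \<Longrightarrow> prob (D k \<inter> D l) = p\<^sup>2"
    and a: "\<And>k. expectation (\<lambda>x. u x * indicator (D k) x) = a"
  shows "a = expectation u * p"
proof -
  define Z where "Z k x = indicator (D k) x - p" for k x
  have p: "0 \<le> p" "p \<le> 1" using D(2)[of 0] by (auto simp flip: D(2)[of 0])
  have Zb: "\<bar>Z k x\<bar> \<le> 1" for k x using p by (auto simp: Z_def indicator_def)
  have Zm[measurable]: "Z k \<in> borel_measurable M" for k using D(1) unfolding Z_def by measurable
  note u(1)[measurable]
  have ui: "integrable M u"
    using u by (intro integrable_const_bound[where B=1]) auto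
  have Di: "integrable M (indicator (D k) :: 'a \<Rightarrow> real)" for k
    using D(1) by (intro integrable_real_indicator) (auto simp: less_top[symmetric])
  have ZZi: "integrable M (\<lambda>x. Z k x * Z l x)" for k l
    using mult_mono[OF Zb[of k] Zb[of l]]
    by (intro integrable_const_bound[where B=1]) (auto simp: abs_mult)
  have uDi: "integrable M (\<lambda>x. u x * indicator (D k) x)" for k
    using u D(1) by (intro integrable_const_bound[where B=1]) (auto simp: indicator_def)
  have ZZ: "expectation (\<lambda>x. Z k x * Z l x) = prob (D k \<inter> D l) - p\<^sup>2" for k l
  proof -
    have "expectation (\<lambda>x. Z k x * Z l x) =
        expectation (\<lambda>x. indicator (D k \<inter> D l) x - p * indicator (D k) x - p * indicator (D l) x + p\<^sup>2)"
      by (intro Bochner_Integration.integral_cong refl)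
         (auto simp: Z_def indicator_def power2_eq_square algebra_simps)
    also have "\<dots> = prob (D k \<inter> D l) - p * prob (D k) - p * prob (D l) + p\<^sup>2"
      using Di D(1) by (subst Bochner_Integration.integral_add Bochner_Integration.integral_diff;
        (auto intro!: integrable_real_indicator simp: less_top[symmetric] prob_space)?)+
    finally show ?thesis by (simp add: D(2) power2_eq_square)
  qed
  have uZ: "expectation (\<lambda>x. u x * Z k x) = a - expectation u * p" for k
  proof -
    have "expectation (\<lambda>x. u x * Z k x) = expectation (\<lambda>x. u x * indicator (D k) x - u x * p)"
      by (intro Bochner_Integration.integral_cong refl) (simp add: Z_def algebra_simps)
    also have "\<dots> = a - expectation u * p"
      using uDi ui by (subst Bochner_Integration.integral_diff) (auto simp: a)
    finally show ?thesis .
  qed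
  have uZi: "integrable M (\<lambda>x. u x * Z k x)" for k
    using u mult_mono[of "u _" 1 "\<bar>Z k _\<bar>" 1] Zb
    by (intro integrable_const_bound[where B=1]) (auto simp: abs_mult)
  define b where "b = a - expectation u * p"
  have "real K * b\<^sup>2 \<le> 1" for K
  proof (cases "K = 0")
    case False
    define S where "S x = (\<Sum>k<K. Z k x)" for x
    have S[measurable]: "S \<in> borel_measurable M" unfolding S_def by measurable
    have S2: "(S x)\<^sup>2 = (\<Sum>k<K. \<Sum>l<K. Z k x * Z l x)" for x
      by (simp add: S_def power2_eq_square sum_product)
    have S2i: "integrable M (\<lambda>x. (S x)\<^sup>2)"
      unfolding S2 by (intro Bochner_Integration.integrable_sum ZZi)
    have uS: "(u x * S x)\<^sup>2 \<le> (S x)\<^sup>2" for x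
    proof -
      have "(u x)\<^sup>2 \<le> 1" using u(2,3)[of x] by (simp add: power_le_one)
      then show ?thesis using mult_right_mono[of "(u x)\<^sup>2" 1 "(S x)\<^sup>2"] by (simp add: power_mult_distrib)
    qed
    have uS2i: "integrable M (\<lambda>x. (u x * S x)\<^sup>2)"
      using uS by (intro Bochner_Integration.integrable_bound[OF S2i]) auto
    have uS_eq: "u x * S x = (\<Sum>k<K. u x * Z k x)" for x
      by (simp add: S_def sum_distrib_left)
    have "(real K * b)\<^sup>2 = (expectation (\<lambda>x. u x * S x))\<^sup>2"
      unfolding uS_eq using uZi by (simp add: Bochner_Integration.integral_sum uZ b_def)
    also have "\<dots> \<le> expectation (\<lambda>x. (u x * S x)\<^sup>2)"
      using uS2i by (intro square_expectation_le) (simp_all add: uS_eq uZi)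
    also have "\<dots> \<le> expectation (\<lambda>x. (S x)\<^sup>2)"
      using uS2i S2i uS by (intro integral_mono)
    also have "\<dots> = (\<Sum>k<K. \<Sum>l<K. prob (D k \<inter> D l) - p\<^sup>2)"
      unfolding S2 using ZZi by (simp add: Bochner_Integration.integral_sum ZZ)
    also have "\<dots> = (\<Sum>k<K. \<Sum>l<K. if k = l then p - p\<^sup>2 else 0)"
      by (intro sum.cong refl) (auto simp: D)
    also have "\<dots> = K * (p - p\<^sup>2)" by simp
    also have "\<dots> \<le> real K * 1" using p by (intro mult_left_mono) (auto intro: order_trans[OF _ p(2)])
    finally have "real K * (real K * b\<^sup>2) \<le> real K * 1" by (simp add: power2_eq_square algebra_simps)
    then show ?thesis using False by (simp add: mult_le_cancel_left)
  qed simp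
  then have "b\<^sup>2 \<le> 0"
    using reals_Archimedean3[of "b\<^sup>2"] by (meson not_le)
  then show ?thesis by (simp add: b_def)
qed

text \<open>The labels \<open>L\<close> are kept apart from the coordinates \<open>\<tau> l\<close> so that the intersection of two translates of one
  cylinder is an instance, with pairs as labels.\<close>

lemma measure_reindexed_cylinder:
  assumes P: "prob_space P" and \<tau>: "inj_on \<tau> L" "\<tau> \<in> L \<rightarrow> K" and L: "finite L"
    and A: "\<And>l. l \<in> L \<Longrightarrow> A l \<in> sets P"
  shows "{x \<in> space (Pi\<^sub>M K (\<lambda>_. P)). \<forall>l\<in>L. x (\<tau> l) \<in> A l} \<in> sets (Pi\<^sub>M K (\<lambda>_. P))"
    and "measure (Pi\<^sub>M K (\<lambda>_. P)) {x \<in> space (Pi\<^sub>M K (\<lambda>_. P)). \<forall>l\<in>L. x (\<tau> l) \<in> A l} = (\<Prod>l\<in>L. measure P (A l))"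
proof -
  interpret P: prob_space P by fact
  interpret L: finite_product_prob_space "\<lambda>_. P" L by unfold_locales (rule L)
  let ?T = "\<lambda>x. \<lambda>l\<in>L. x (\<tau> l)"
  note T = measure_preserving_reindex[OF P \<tau>]
  have eq: "{x \<in> space (Pi\<^sub>M K (\<lambda>_. P)). \<forall>l\<in>L. x (\<tau> l) \<in> A l} = ?T -` (Pi\<^sub>E L A) \<inter> space (Pi\<^sub>M K (\<lambda>_. P))"
    by (auto simp: PiE_iff)
  have E: "Pi\<^sub>E L A \<in> sets (Pi\<^sub>M L (\<lambda>_. P))" using A L by (intro sets_PiM_I_finite) auto
  show "{x \<in> space (Pi\<^sub>M K (\<lambda>_. P)). \<forall>l\<in>L. x (\<tau> l) \<in> A l} \<in> sets (Pi\<^sub>M K (\<lambda>_. P))"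
    unfolding eq by (rule measurable_sets[OF T(1) E])
  have "measure (Pi\<^sub>M K (\<lambda>_. P)) (?T -` (Pi\<^sub>E L A) \<inter> space (Pi\<^sub>M K (\<lambda>_. P))) =
      measure (distr (Pi\<^sub>M K (\<lambda>_. P)) (Pi\<^sub>M L (\<lambda>_. P)) ?T) (Pi\<^sub>E L A)"
    by (rule measure_distr[OF T(1) E, symmetric])
  also have "\<dots> = measure (Pi\<^sub>M L (\<lambda>_. P)) (Pi\<^sub>E L A)" by (simp only: T(2))
  also have "\<dots> = (\<Prod>l\<in>L. measure P (A l))"
    using A by (rule L.finite_measure_PiM_emb)
  finally show "measure (Pi\<^sub>M K (\<lambda>_. P)) {x \<in> space (Pi\<^sub>M K (\<lambda>_. P)). \<forall>l\<in>L. x (\<tau> l) \<in> A l} = (\<Prod>l\<in>L. measure P (A l))"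
    unfolding eq .
qed

text \<open>The blocks of \<open>n\<close> coordinates that start after \<open>0\<close> and after \<open>d\<close> are disjoint, so exchanging them is an
  involution.\<close>

lemma block_swap:
  fixes n d :: nat
  assumes "n \<le> d"
  obtains \<pi> where "\<pi> permutes {1..}" "\<And>j. j \<in> {1..n} \<Longrightarrow> \<pi> j = j + d"
proof -
  define \<pi> where "\<pi> j = (if j \<in> {1..n} then j + d else if j \<in> {d + 1..d + n} then j - d else j)" for j
  have "\<pi> (\<pi> j) = j" for j using assms by (auto simp: \<pi>_def)
  then have "bij \<pi>" by (intro o_bij[of \<pi>]) (auto simp: fun_eq_iff)
  then have "\<pi> permutes {1..}"
    by (auto simp: permutes_def bij_iff \<pi>_def)
  then show thesis by (rule that) (simp add: \<pi>_def)
qed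

text \<open>The translates \<open>D k\<close> of the cylinder \<open>C\<close> to disjoint blocks of coordinates are independent of each other and
  have the probability of \<open>C\<close>. By invariance under the permutation that swaps the blocks, \<open>u\<close> has the same
  integral over \<open>C\<close> as over each \<open>D k\<close>, so the law of large numbers above applies.\<close>

lemma invariant_independent_of_cylinder:
  fixes P :: "'a measure" and u :: "(nat \<Rightarrow> 'a) \<Rightarrow> real"
  defines "Q \<equiv> Pi\<^sub>M {1..} (\<lambda>_. P)"
  assumes P: "prob_space P"
    and u: "u \<in> borel_measurable Q" "\<And>x. 0 \<le> u x" "\<And>x. u x \<le> 1"
    and inv: "\<And>\<pi>. \<pi> permutes {1..} \<Longrightarrow> AE x in Q. u (\<lambda>k\<in>{1..}. x (\<pi> k)) = u x"
    and J: "finite J" "J \<subseteq> {1..}" and A: "\<And>j. j \<in> J \<Longrightarrow> A j \<in> sets P"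
    and C_def: "C = {x \<in> space Q. \<forall>j\<in>J. x j \<in> A j}"
  shows "C \<in> sets Q" and "(\<integral>x. u x * indicator C x \<partial>Q) = (\<integral>x. u x \<partial>Q) * measure Q C"
proof -
  interpret Q: prob_space Q unfolding Q_def using P by (intro prob_space_PiM)
  obtain n where n: "J \<subseteq> {1..n}"
    using J finite_nat_set_iff_bounded_le[of J] by (metis atLeastAtMost_iff atLeast_iff subset_iff)
  define p where "p = (\<Prod>j\<in>J. measure P (A j))"
  note cyl = measure_reindexed_cylinder[where K="{1::nat..}", OF P, folded Q_def]
  show C: "C \<in> sets Q" unfolding C_def using J A by (intro cyl(1)[where \<tau>="\<lambda>j. j"]) auto
  have "measure Q C = p"
    unfolding C_def p_def using J A by (intro cyl(2)[where \<tau>="\<lambda>j. j"]) auto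
  \<comment> \<open>The shift is \<open>(k + 1) n\<close> and not \<open>k n\<close>, so that every block is disjoint from the first one, with which it is swapped.\<close>
  define D where "D k = {x \<in> space Q. \<forall>j\<in>J. x (j + (k + 1) * n) \<in> A j}" for k
  have "(\<integral>x. u x * indicator C x \<partial>Q) = (\<integral>x. u x \<partial>Q) * p"
  proof (rule Q.expectation_product_pairwise_independent[OF u, of D])
    fix k
    show D: "D k \<in> sets Q" unfolding D_def
      using J A by (intro cyl(1)[where \<tau>="\<lambda>j. j + (k + 1) * n"]) (auto simp: inj_on_def)
    show "measure Q (D k) = p" unfolding D_def p_def
      using J A by (intro cyl(2)[where \<tau>="\<lambda>j. j + (k + 1) * n"]) (auto simp: inj_on_def)
    obtain \<pi> where \<pi>: "\<pi> permutes {1..}" "\<And>j. j \<in> {1..n} \<Longrightarrow> \<pi> j = j + (k + 1) * n"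
      using block_swap[of n "(k + 1) * n"] by auto
    let ?T = "\<lambda>x. \<lambda>k\<in>{1..}. x (\<pi> k)"
    have "\<pi> \<in> {1..} \<rightarrow> {1..}" using permutes_in_image[OF \<pi>(1)] by auto
    note T = measure_preserving_reindex[OF P permutes_inj_on[OF \<pi>(1)] this, folded Q_def]
    have mem: "(?T x \<in> C) = (x \<in> D k)" if "x \<in> space Q" for x
      using that measurable_space[OF T(1) that] n J(2) \<pi>(2) unfolding C_def D_def
      by (auto simp: subset_iff)
    have "(\<integral>x. u x * indicator C x \<partial>Q) = (\<integral>x. u x * indicator C x \<partial>distr Q Q ?T)"
      by (simp only: T(2))
    also have "\<dots> = (\<integral>x. u (?T x) * indicator C (?T x) \<partial>Q)"
      using T(1) u(1) C by (intro integral_distr) auto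
    also have "\<dots> = (\<integral>x. u x * indicator (D k) x \<partial>Q)"
    proof (rule integral_cong_AE)
      show "AE x in Q. u (?T x) * indicator C (?T x) = u x * indicator (D k) x"
        using inv[OF \<pi>(1)] AE_space
      proof eventually_elim
        case (elim x)
        then show ?case using mem[of x] by (simp add: indicator_def)
      qed
      show "(\<lambda>x. u (?T x) * indicator C (?T x)) \<in> borel_measurable Q"
        using u(1) C by (intro measurable_compose[OF T(1)]) auto
    qed (use u(1) D in auto)
    finally show "(\<integral>x. u x * indicator (D k) x \<partial>Q) = (\<integral>x. u x * indicator C x \<partial>Q)" ..
  next
    fix k l :: nat assume kl: "k \<noteq> l"
    let ?\<tau> = "\<lambda>(j, i). j + (i + 1) * n"
    have inj: "inj_on ?\<tau> (J \<times> {k, l})"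
    proof (rule inj_onI, clarify)
      fix j i j' i' assume *: "j \<in> J" "j' \<in> J" "j + (i + 1) * n = j' + (i' + 1) * n"
      \<comment> \<open>The block number is recovered by integer division; blocks are \<open>{1..n}\<close> shifted, hence the \<open>- 1\<close>.\<close>
      have "(j + (i + 1) * n - 1) div n = i + 1" if "j \<in> J" for i j
      proof -
        have "1 \<le> j" "j \<le> n" using n that by auto
        then have "j + (i + 1) * n - 1 = (j - 1) + (i + 1) * n" by linarith
        also have "\<dots> div n = (i + 1) + (j - 1) div n"
          using \<open>1 \<le> j\<close> \<open>j \<le> n\<close> by (intro div_mult_self1) linarith
        also have "(j - 1) div n = 0"
          using \<open>1 \<le> j\<close> \<open>j \<le> n\<close> by (intro div_less) linarith
        finally show ?thesis by linarith
      qed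
      from this[OF *(1), of i] this[OF *(2), of i'] have "i + 1 = i' + 1"
        unfolding *(3) by simp
      then have "i = i'" by simp
      with *(3) show "j = j' \<and> i = i'" by simp
    qed
    have "D k \<inter> D l = {x \<in> space Q. \<forall>q\<in>J \<times> {k, l}. x (?\<tau> q) \<in> A (fst q)}"
      by (auto simp: D_def)
    also have "measure Q \<dots> = (\<Prod>q\<in>J \<times> {k, l}. measure P (A (fst q)))"
      using J A inj by (intro cyl(2)) auto
    also have "\<dots> = (\<Prod>j\<in>J. \<Prod>i\<in>{k, l}. measure P (A j))"
      by (subst prod.cartesian_product) (simp add: case_prod_beta)
    also have "\<dots> = p\<^sup>2"
      using kl by (simp add: p_def power2_eq_square prod.distrib)
    finally show "measure Q (D k \<inter> D l) = p\<^sup>2" .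
  qed
  then show "(\<integral>x. u x * indicator C x \<partial>Q) = (\<integral>x. u x \<partial>Q) * measure Q C"
    by (simp add: \<open>measure Q C = p\<close>)
qed

text \<open>Cylinders generate the \<open>\<sigma>\<close>-field and are stable under intersection, so independence of all cylinders says that
  \<open>u\<close> and the constant \<open>\<integral> u\<close> are densities of the same measure. Invariance is required only almost everywhere
  because it is inherited from a symmetric function that agrees with \<open>u\<close> almost everywhere.\<close>

theorem Hewitt_Savage:
  fixes P :: "'a measure" and u :: "(nat \<Rightarrow> 'a) \<Rightarrow> real"
  defines "Q \<equiv> Pi\<^sub>M {1..} (\<lambda>_. P)"
  assumes P: "prob_space P"
    and u: "u \<in> borel_measurable Q" "\<And>x. 0 \<le> u x" "\<And>x. u x \<le> 1"
    and inv: "\<And>\<pi>. \<pi> permutes {1..} \<Longrightarrow> AE x in Q. u (\<lambda>k\<in>{1..}. x (\<pi> k)) = u x"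
  shows "AE x in Q. u x = (\<integral>x. u x \<partial>Q)"
proof -
  interpret Q: prob_space Q unfolding Q_def using P by (intro prob_space_PiM)
  define c where "c = (\<integral>x. u x \<partial>Q)"
  have c: "0 \<le> c" unfolding c_def using u(2) by simp
  note u(1)[measurable]
  have ui: "integrable Q u" using u by (intro Q.integrable_const_bound[where B=1]) auto
  have "density Q (\<lambda>x. ennreal (u x)) = density Q (\<lambda>_. ennreal c)"
  proof (rule measure_eqI_PiM_infinite)
    show "sets (density Q (\<lambda>x. ennreal (u x))) = sets (Pi\<^sub>M {1..} (\<lambda>_. P))"
      "sets (density Q (\<lambda>_. ennreal c)) = sets (Pi\<^sub>M {1..} (\<lambda>_. P))"
      by (simp_all add: Q_def)
    show "finite_measure (density Q (\<lambda>x. ennreal (u x)))"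
      using ui u(2) by (intro finite_measureI) (simp add: emeasure_density nn_integral_eq_integral)
    fix A and J :: "nat set" assume J: "finite J" "J \<subseteq> {1..}" and A: "\<And>i. i \<in> J \<Longrightarrow> A i \<in> sets P"
    define C where "C = {x \<in> space Q. \<forall>j\<in>J. x j \<in> A j}"
    have emb: "prod_emb {1..} (\<lambda>_. P) J (Pi\<^sub>E J A) = C"
      using J(2) by (auto simp: C_def Q_def prod_emb_def space_PiM PiE_iff restrict_def extensional_def)
    note C = invariant_independent_of_cylinder[OF P, folded Q_def, OF u inv J A C_def, simplified]
    have "emeasure (density Q (\<lambda>x. ennreal (u x))) C = (\<integral>\<^sup>+x. ennreal (u x * indicator C x) \<partial>Q)"
      using C(1) u(1) by (simp add: emeasure_density ennreal_mult' ennreal_indicator u(2))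
    also have "\<dots> = ennreal (\<integral>x. u x * indicator C x \<partial>Q)"
      using C(1) ui u(2) by (intro nn_integral_eq_integral integrable_real_mult_indicator) auto
    also have "\<dots> = ennreal c * ennreal (measure Q C)"
      using C(2) c by (simp add: c_def ennreal_mult)
    also have "\<dots> = emeasure (density Q (\<lambda>_. ennreal c)) C"
      using C(1) by (simp add: emeasure_density_const Q.emeasure_eq_measure)
    finally show "emeasure (density Q (\<lambda>x. ennreal (u x))) (prod_emb {1..} (\<lambda>_. P) J (Pi\<^sub>E J A)) =
        emeasure (density Q (\<lambda>_. ennreal c)) (prod_emb {1..} (\<lambda>_. P) J (Pi\<^sub>E J A))"
      by (simp only: emb)
  qed
  then have "AE x in Q. ennreal (u x) = ennreal c"
    by (intro Q.density_unique) auto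
  then show ?thesis unfolding c_def[symmetric] using c u(2) by simp
qed

section \<open>Quantile functions on the unit interval\<close>

lemma prob_space_unit_lebesgue: "prob_space unit_lebesgue"
  by (intro prob_spaceI) (simp add: unit_lebesgue_def space_restrict_space emeasure_restrict_space)

text \<open>The quantile function transports the uniform distribution on the open unit interval to \<open>\<mu>\<close>. It need not be
  finite at the two end points, where \<open>0\<close> is substituted.\<close>

lemma ex_unit_lebesgue_pushforward:
  assumes \<mu>: "prob_space \<mu>" "sets \<mu> = sets (borel :: real measure)"
  obtains \<psi> :: "real \<Rightarrow> real" where "\<psi> \<in> borel_measurable unit_lebesgue" "distr unit_lebesgue borel \<psi> = \<mu>"
proof -
  interpret cdf_distribution \<mu>
    using \<mu> by (intro cdf_distribution.intro real_distribution.intro real_distribution_axioms.intro)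
  define \<psi> where "\<psi> x = (if x \<in> {0<..<1} then I x else 0)" for x
  have \<psi>: "\<psi> \<in> borel_measurable borel"
    unfolding \<psi>_def using measurable_CI
    by (subst measurable_If_restrict_space_iff) (auto simp del: greaterThanLessThan_iff)
  have "distr unit_lebesgue borel \<psi> = distr (restrict_space lborel {0<..<1}) borel I"
  proof (rule measure_eqI)
    fix A assume "A \<in> sets (distr unit_lebesgue borel \<psi>)"
    then have A[measurable]: "A \<in> sets borel" by simp
    have \<psi>A: "\<psi> -` A \<in> sets borel" using measurable_sets[OF \<psi> A] by simp
    have "emeasure (distr unit_lebesgue borel \<psi>) A = emeasure lborel (\<psi> -` A \<inter> {0..1})"
      using \<psi> by (subst emeasure_distr)
        (auto simp: unit_lebesgue_def space_restrict_space emeasure_restrict_space intro!: measurable_restrict_space1)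
    also have "\<psi> -` A \<inter> {0..1} = (\<psi> -` A \<inter> {0<..<1}) \<union> (\<psi> -` A \<inter> {0, 1})"
      by (auto simp: order_less_le)
    also have "emeasure lborel \<dots> = emeasure lborel (\<psi> -` A \<inter> {0<..<1})"
    proof (rule emeasure_Un_null_set)
      show "\<psi> -` A \<inter> {0, 1} \<in> null_sets lborel"
        by (rule finite_imp_null_set_lborel) auto
    qed (use \<psi>A in auto)
    also have "\<psi> -` A \<inter> {0<..<1} = I -` A \<inter> {0<..<1}"
      by (auto simp: \<psi>_def)
    also have "emeasure lborel \<dots> = emeasure (distr (restrict_space lborel {0<..<1}) borel I) A"
      using measurable_CI
      by (subst emeasure_distr) (auto simp: space_restrict_space emeasure_restrict_space cong: measurable_cong_sets)
    finally show "emeasure (distr unit_lebesgue borel \<psi>) A = \<dots>" .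
  qed simp
  then have "distr unit_lebesgue borel \<psi> = \<mu>" by (simp add: distr_I_eq_M)
  moreover have "\<psi> \<in> borel_measurable unit_lebesgue"
    using \<psi> unfolding unit_lebesgue_def by (intro measurable_restrict_space1) simp
  ultimately show thesis using that by blast
qed

section \<open>Symmetric factors\<close>

abbreviation permute_coords :: "nat set \<Rightarrow> (nat \<Rightarrow> nat) \<Rightarrow> (nat \<Rightarrow> 'a) \<Rightarrow> nat \<Rightarrow> 'a" where
  "permute_coords J \<pi> x \<equiv> \<lambda>k\<in>J. x (\<pi> k)"

lemma map_coords_permute_coords:
  assumes "\<pi> permutes J"
  shows "map_coords J \<phi> (permute_coords J \<pi> x) = permute_coords J \<pi> (map_coords J \<phi> x)"
  using permutes_in_image[OF assms] by (auto simp: map_coords_def fun_eq_iff)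

lemma permutation_preserves_measure:
  assumes "prob_space P" "\<pi> permutes J"
  shows "permute_coords J \<pi> \<in> Pi\<^sub>M J (\<lambda>_. P) \<rightarrow>\<^sub>M Pi\<^sub>M J (\<lambda>_. P)"
    and "distr (Pi\<^sub>M J (\<lambda>_. P)) (Pi\<^sub>M J (\<lambda>_. P)) (permute_coords J \<pi>) = Pi\<^sub>M J (\<lambda>_. P)"
proof -
  have "\<pi> \<in> J \<rightarrow> J" using permutes_in_image[OF assms(2)] by auto
  then show "permute_coords J \<pi> \<in> Pi\<^sub>M J (\<lambda>_. P) \<rightarrow>\<^sub>M Pi\<^sub>M J (\<lambda>_. P)"
    and "distr (Pi\<^sub>M J (\<lambda>_. P)) (Pi\<^sub>M J (\<lambda>_. P)) (permute_coords J \<pi>) = Pi\<^sub>M J (\<lambda>_. P)"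
    using measure_preserving_reindex[OF assms(1) permutes_inj_on[OF assms(2)]] by blast+
qed

lemma symmetric_funD:
  assumes "symmetric_fun P m f" "x \<in> space (power_measure P m)" "\<pi> permutes coords m"
  shows "f (permute_coords (coords m) \<pi> x) = f x"
  using assms unfolding symmetric_fun_def by blast

lemma symmetric_fun_comp:
  assumes "symmetric_fun P m f"
  shows "symmetric_fun P m (\<lambda>x. c (f x))"
  unfolding symmetric_fun_def using arg_cong[OF symmetric_funD[OF assms], of _ _ c] by blast

text \<open>A permutation of the coordinates preserves null sets, so a function that agrees almost everywhere with a
  symmetric one is almost everywhere invariant.\<close>

lemma symmetric_AE_permute:
  assumes P: "prob_space P" and v: "symmetric_fun P m v"
    and ae: "AE x in power_measure P m. v x = w x" and \<pi>: "\<pi> permutes coords m"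
  shows "AE x in power_measure P m. w (permute_coords (coords m) \<pi> x) = v x"
proof -
  note T = permutation_preserves_measure[OF P \<pi>]
  have "AE x in power_measure P m. v (permute_coords (coords m) \<pi> x) = w (permute_coords (coords m) \<pi> x)"
    by (rule AE_distrD[OF T(1)]) (simp only: T(2) ae)
  then show ?thesis using AE_space
  proof eventually_elim
    case (elim x)
    then show ?case using symmetric_funD[OF v elim(2) \<pi>] by simp
  qed
qed

text \<open>Instead of the maximum, any symmetric function of the finitely many values would do that is measurable and
  returns their common value when they all agree.\<close>

definition symmetrized_max :: "nat set \<Rightarrow> ((nat \<Rightarrow> 'a) \<Rightarrow> real) \<Rightarrow> (nat \<Rightarrow> 'a) \<Rightarrow> real" where
  "symmetrized_max J h y = (MAX \<pi>\<in>{\<pi>. \<pi> permutes J}. h (permute_coords J \<pi> y))"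

lemma measurable_symmetrized_max:
  assumes "finite J" "h \<in> borel_measurable (Pi\<^sub>M J (\<lambda>_. R))"
  shows "symmetrized_max J h \<in> borel_measurable (Pi\<^sub>M J (\<lambda>_. R))"
  unfolding symmetrized_max_def[abs_def]
proof (rule borel_measurable_Max)
  fix \<pi> assume "\<pi> \<in> {\<pi>. \<pi> permutes J}"
  then have "\<pi> k \<in> J" if "k \<in> J" for k using that permutes_in_image[of \<pi> J k] by simp
  then have "permute_coords J \<pi> \<in> Pi\<^sub>M J (\<lambda>_. R) \<rightarrow>\<^sub>M Pi\<^sub>M J (\<lambda>_. R)"
    by (intro measurable_restrict measurable_component_singleton)
  then show "(\<lambda>y. h (permute_coords J \<pi> y)) \<in> borel_measurable (Pi\<^sub>M J (\<lambda>_. R))"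
    using assms(2) by (rule measurable_compose)
qed (simp add: finite_permutations assms(1))

lemma symmetrized_max_permute:
  assumes \<rho>: "\<rho> permutes J"
  shows "symmetrized_max J h (permute_coords J \<rho> y) = symmetrized_max J h y"
proof -
  have eq: "permute_coords J \<pi> (permute_coords J \<rho> y) = permute_coords J (\<rho> \<circ> \<pi>) y" if "\<pi> permutes J" for \<pi>
    using permutes_in_image[OF that] by (auto simp: fun_eq_iff)
  have "(\<lambda>\<pi>. h (permute_coords J \<pi> (permute_coords J \<rho> y))) ` {\<pi>. \<pi> permutes J} =
      (\<lambda>\<pi>. h (permute_coords J (\<rho> \<circ> \<pi>) y)) ` {\<pi>. \<pi> permutes J}"
    by (intro image_cong refl) (simp only: eq mem_Collect_eq)
  also have "\<dots> = (\<lambda>\<pi>. h (permute_coords J \<pi> y)) ` ((\<circ>) \<rho> ` {\<pi>. \<pi> permutes J})"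
    by (simp only: image_image)
  also have "(\<circ>) \<rho> ` {\<pi>. \<pi> permutes J} = {\<pi>. \<pi> permutes J}"
    using image_compose_permutations_left[OF \<rho>] by blast
  finally show ?thesis by (simp only: symmetrized_max_def)
qed

text \<open>Two unrelated reasons according to \<open>m\<close>. For finite \<open>m\<close>, the factor \<open>h\<close> is invariant at almost every point of the
  form \<open>(\<phi> x\<^sub>1, \<dots>, \<phi> x\<^sub>m)\<close>, and the maximum over the permutations makes it invariant everywhere. For infinite
  \<open>m\<close>, the function \<open>v\<close> is almost everywhere constant.\<close>

lemma symmetric_factor:
  assumes P: "prob_space P" and \<phi>: "\<phi> \<in> P \<rightarrow>\<^sub>M R"
    and h: "h \<in> borel_measurable (power_measure R m)"
    and v: "symmetric_fun P m v" "\<And>x. x \<in> space (power_measure P m) \<Longrightarrow> 0 \<le> v x \<and> v x \<le> (1::real)"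
    and ae: "AE x in power_measure P m. v x = h (map_coords (coords m) \<phi> x)"
  obtains h' where "h' \<in> borel_measurable (power_measure R m)" "symmetric_fun R m h'"
    "AE x in power_measure P m. v x = h' (map_coords (coords m) \<phi> x)"
proof (cases m)
  case (enat n)
  have "coords m \<subseteq> {..n}" by (auto simp: coords_def enat)
  then have J: "finite (coords m)" by (rule finite_subset) simp
  show thesis
  proof (rule that)
    show "symmetrized_max (coords m) h \<in> borel_measurable (power_measure R m)"
      using J h by (rule measurable_symmetrized_max)
    show "symmetric_fun R m (symmetrized_max (coords m) h)"
      by (simp add: symmetric_fun_def symmetrized_max_permute)
    have "AE x in power_measure P m. \<forall>\<pi>\<in>{\<pi>. \<pi> permutes coords m}.
        h (map_coords (coords m) \<phi> (permute_coords (coords m) \<pi> x)) = v x"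
      by (rule AE_finite_allI) (use J symmetric_AE_permute[OF P v(1) ae] in \<open>auto simp: finite_permutations\<close>)
    then show "AE x in power_measure P m. v x = symmetrized_max (coords m) h (map_coords (coords m) \<phi> x)"
    proof eventually_elim
      case (elim x)
      then have "(\<lambda>\<pi>. h (permute_coords (coords m) \<pi> (map_coords (coords m) \<phi> x))) ` {\<pi>. \<pi> permutes coords m} = {v x}"
        using permutes_id[of "coords m"] by (auto simp: map_coords_permute_coords image_iff intro!: exI[of _ id])
      then show ?case by (simp add: symmetrized_max_def)
    qed
  qed
next
  case infinity
  define u where "u x = max 0 (min 1 (h (map_coords (coords m) \<phi> x)))" for x
  have vu: "AE x in power_measure P m. v x = u x"
    using ae AE_space
  proof eventually_elim
    case (elim x)
    then show ?case using v(2)[of x] by (simp add: u_def)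
  qed
  have "AE x in Pi\<^sub>M {1..} (\<lambda>_. P). u x = (\<integral>x. u x \<partial>Pi\<^sub>M {1..} (\<lambda>_. P))"
  proof (rule Hewitt_Savage[OF P])
    have "(\<lambda>x. h (map_coords (coords m) \<phi> x)) \<in> borel_measurable (power_measure P m)"
      using measurable_map_coords[OF \<phi>] h by (rule measurable_compose)
    then show "u \<in> borel_measurable (Pi\<^sub>M {1..} (\<lambda>_. P))"
      unfolding u_def by (simp add: infinity coords_infinity)
    fix \<pi> :: "nat \<Rightarrow> nat" assume "\<pi> permutes {1..}"
    then have "AE x in power_measure P m. u (permute_coords (coords m) \<pi> x) = v x"
      by (intro symmetric_AE_permute[OF P v(1) vu]) (simp add: infinity coords_infinity)
    with vu have "AE x in power_measure P m. u (permute_coords (coords m) \<pi> x) = u x"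
      by eventually_elim simp
    then show "AE x in Pi\<^sub>M {1..} (\<lambda>_. P). u (permute_coords {1..} \<pi> x) = u x"
      unfolding infinity coords_infinity .
  qed (auto simp: u_def)
  then have "AE x in power_measure P m. u x = (\<integral>x. u x \<partial>Pi\<^sub>M {1..} (\<lambda>_. P))"
    unfolding infinity coords_infinity .
  with vu have "AE x in power_measure P m. v x = (\<integral>x. u x \<partial>Pi\<^sub>M {1..} (\<lambda>_. P))"
    by eventually_elim simp
  then show thesis
    by (intro that[of "\<lambda>_. \<integral>x. u x \<partial>Pi\<^sub>M {1..} (\<lambda>_. P)"]) (simp_all add: symmetric_fun_def)
qed

section \<open>Representation on the unit interval\<close>

lemma completion_measurable_unit_interval_version:
  fixes v :: "'a \<Rightarrow> real"
  assumes v: "v \<in> borel_measurable (completion M)" and bounds: "\<And>x. x \<in> space M \<Longrightarrow> 0 \<le> v x \<and> v x \<le> 1"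
  obtains u where "u \<in> borel_measurable M" "\<And>x. 0 \<le> u x" "AE x in M. v x = u x"
proof -
  obtain u where u: "u \<in> borel_measurable M" "AE x in M. v x = u x"
    using completion_ex_borel_measurable_real[OF v] by blast
  show thesis
  proof
    show "(\<lambda>x. max 0 (u x)) \<in> borel_measurable M" using u(1) by measurable
    show "AE x in M. v x = max 0 (u x)"
      using u(2) AE_space
    proof eventually_elim
      case (elim x)
      then show ?case using bounds[of x] by simp
    qed
  qed simp
qed

text \<open>The inverse \<open>d\<close> of the chart is extended to the whole real line by a constant, so that real functions need not
  be kept within the image of the chart.\<close>

lemma borel_isomorphic_space_chart:
  assumes "borel_isomorphic_space S" "space S \<noteq> {}"
  obtains c :: "'s \<Rightarrow> real" and d :: "real \<Rightarrow> 's" where "c \<in> borel_measurable S" "d \<in> borel \<rightarrow>\<^sub>M S"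
    "\<And>s. s \<in> space S \<Longrightarrow> d (c s) = s \<and> 0 \<le> c s \<and> c s \<le> 1"
proof -
  obtain B c where B: "B \<in> sets (borel :: real measure)" "B \<subseteq> {0..1}" and bij: "bij_betw c (space S) B"
    and c: "c \<in> S \<rightarrow>\<^sub>M restrict_space borel B"
    and inv: "the_inv_into (space S) c \<in> restrict_space borel B \<rightarrow>\<^sub>M S"
    using assms(1) by (auto simp: borel_isomorphic_space_def)
  obtain s0 where s0: "s0 \<in> space S" using assms(2) by auto
  show thesis
  proof
    show "c \<in> borel_measurable S" using c by (simp add: measurable_restrict_space2_iff)
    show "(\<lambda>t. if t \<in> B then the_inv_into (space S) c t else s0) \<in> borel \<rightarrow>\<^sub>M S"
      using B(1) inv s0 by (subst measurable_If_restrict_space_iff) auto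
    fix s assume "s \<in> space S"
    then show "(if c s \<in> B then the_inv_into (space S) c (c s) else s0) = s \<and> 0 \<le> c s \<and> c s \<le> 1"
      using bij B(2) by (auto simp: bij_betw_def the_inv_into_f_f)
  qed
qed

text \<open>In the charts of the \<open>S i\<close> the family becomes real valued with values in the unit interval. It is changed on null
  sets, factored through a common \<open>\<phi>\<close>, made symmetric for those \<open>i\<close> whose \<open>f i\<close> is symmetric, and mapped back to the \<open>S i\<close>.\<close>

lemma common_real_factor:
  fixes P :: "'a measure" and S :: "'i \<Rightarrow> 's measure" and f :: "'i \<Rightarrow> (nat \<Rightarrow> 'a) \<Rightarrow> 's"
  assumes P: "prob_space P" and I: "countable I"
    and S: "\<And>i. i \<in> I \<Longrightarrow> borel_isomorphic_space (S i)"
    and f: "\<And>i. i \<in> I \<Longrightarrow> f i \<in> completion (power_measure P (m i)) \<rightarrow>\<^sub>M S i"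
  obtains \<phi> :: "'a \<Rightarrow> real" and k :: "'i \<Rightarrow> (nat \<Rightarrow> real) \<Rightarrow> 's" where "\<phi> \<in> borel_measurable P"
    "\<forall>i\<in>I. k i \<in> power_measure borel (m i) \<rightarrow>\<^sub>M S i"
    "\<forall>i\<in>I. AE x in power_measure P (m i). f i x = k i (map_coords (coords (m i)) \<phi> x)"
    "\<forall>i\<in>I. symmetric_fun P (m i) (f i) \<longrightarrow> symmetric_fun borel (m i) (k i)"
proof -
  have fS: "f i x \<in> space (S i)" if "i \<in> I" "x \<in> space (power_measure P (m i))" for i x
    using measurable_space[OF f[OF that(1)], of x] that(2) by simp
  have "space (S i) \<noteq> {}" if "i \<in> I" for i
    using prob_space.not_empty[OF prob_space_power[OF P, of "m i"]] fS[OF that] by blast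
  then have "\<exists>c d. c \<in> borel_measurable (S i) \<and> d \<in> borel \<rightarrow>\<^sub>M S i \<and>
      (\<forall>s\<in>space (S i). d (c s) = s \<and> 0 \<le> c s \<and> c s \<le> (1::real))" if "i \<in> I" for i
    using borel_isomorphic_space_chart[OF S[OF that]] that by metis
  then obtain c d where c: "\<And>i. i \<in> I \<Longrightarrow> c i \<in> borel_measurable (S i)"
    and d: "\<And>i. i \<in> I \<Longrightarrow> d i \<in> borel \<rightarrow>\<^sub>M S i"
    and cd: "\<And>i s. i \<in> I \<Longrightarrow> s \<in> space (S i) \<Longrightarrow> d i (c i s) = s \<and> 0 \<le> c i s \<and> c i s \<le> (1::real)"
    by metis
  define v where "v i x = c i (f i x)" for i x
  have v: "v i \<in> borel_measurable (completion (power_measure P (m i)))" if "i \<in> I" for i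
    unfolding v_def using f[OF that] c[OF that] by (rule measurable_compose)
  have v01: "0 \<le> v i x \<and> v i x \<le> 1" if "i \<in> I" "x \<in> space (power_measure P (m i))" for i x
    using cd[OF that(1) fS[OF that]] by (simp add: v_def)
  have "\<exists>u. u \<in> borel_measurable (power_measure P (m i)) \<and> (\<forall>x. 0 \<le> u x) \<and>
      (AE x in power_measure P (m i). v i x = u x)" if "i \<in> I" for i
    using completion_measurable_unit_interval_version[OF v[OF that] v01[OF that]] by metis
  then obtain u where u: "\<And>i. i \<in> I \<Longrightarrow> u i \<in> borel_measurable (power_measure P (m i))"
    and u0: "\<And>i x. i \<in> I \<Longrightarrow> 0 \<le> u i x"
    and vu: "\<And>i. i \<in> I \<Longrightarrow> AE x in power_measure P (m i). v i x = u i x"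
    by metis
  obtain \<phi> :: "'a \<Rightarrow> real" and h where \<phi>: "\<phi> \<in> borel_measurable P"
    and h: "\<And>i. i \<in> I \<Longrightarrow> h i \<in> borel_measurable (power_measure borel (m i))"
    and uh: "\<And>i x. i \<in> I \<Longrightarrow> x \<in> space (power_measure P (m i)) \<Longrightarrow> u i x = h i (map_coords (coords (m i)) \<phi> x)"
    using countable_functions_common_factor[where u=u and J="\<lambda>i. coords (m i)", OF I u u0] by blast
  have vh: "AE x in power_measure P (m i). v i x = h i (map_coords (coords (m i)) \<phi> x)" if "i \<in> I" for i
    using vu[OF that] AE_space
  proof eventually_elim
    case (elim x)
    then show ?case using uh[OF that] by simp
  qed
  have "\<exists>h'. h' \<in> borel_measurable (power_measure borel (m i)) \<and>
      (AE x in power_measure P (m i). v i x = h' (map_coords (coords (m i)) \<phi> x)) \<and>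
      (symmetric_fun P (m i) (f i) \<longrightarrow> symmetric_fun borel (m i) h')" if i: "i \<in> I" for i
  proof (cases "symmetric_fun P (m i) (f i)")
    case True
    then have "symmetric_fun P (m i) (v i)" unfolding v_def by (rule symmetric_fun_comp)
    then obtain h' where "h' \<in> borel_measurable (power_measure borel (m i))" "symmetric_fun borel (m i) h'"
      "AE x in power_measure P (m i). v i x = h' (map_coords (coords (m i)) \<phi> x)"
      by (rule symmetric_factor[OF P \<phi> h[OF i] _ v01[OF i] vh[OF i]])
    then show ?thesis by blast
  next
    case False
    then show ?thesis using h[OF i] vh[OF i] by blast
  qed
  then have "\<exists>h'. \<forall>i\<in>I. h' i \<in> borel_measurable (power_measure borel (m i)) \<and>
      (AE x in power_measure P (m i). v i x = h' i (map_coords (coords (m i)) \<phi> x)) \<and>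
      (symmetric_fun P (m i) (f i) \<longrightarrow> symmetric_fun borel (m i) (h' i))"
    by (intro bchoice ballI)
  then obtain h' where h': "\<And>i. i \<in> I \<Longrightarrow> h' i \<in> borel_measurable (power_measure borel (m i))"
    and vh': "\<And>i. i \<in> I \<Longrightarrow> AE x in power_measure P (m i). v i x = h' i (map_coords (coords (m i)) \<phi> x)"
    and sym: "\<And>i. i \<in> I \<Longrightarrow> symmetric_fun P (m i) (f i) \<Longrightarrow> symmetric_fun borel (m i) (h' i)"
    by blast
  show thesis
  proof (rule that[of \<phi> "\<lambda>i y. d i (h' i y)"]; (intro ballI impI)?)
    fix i assume i: "i \<in> I"
    show "(\<lambda>y. d i (h' i y)) \<in> power_measure borel (m i) \<rightarrow>\<^sub>M S i"
      using h'[OF i] d[OF i] by (rule measurable_compose)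
    show "AE x in power_measure P (m i). f i x = d i (h' i (map_coords (coords (m i)) \<phi> x))"
      using vh'[OF i] AE_space
    proof eventually_elim
      case (elim x)
      then show ?case using cd[OF i fS[OF i elim(2)]] by (simp add: v_def)
    qed
    show "symmetric_fun borel (m i) (\<lambda>y. d i (h' i y))" if "symmetric_fun P (m i) (f i)"
      using sym[OF i that] by (rule symmetric_fun_comp)
  qed (fact \<phi>)
qed

theorem theorem7:
  fixes P :: "'a measure" and I :: "'i set" and m :: "'i \<Rightarrow> enat"
    and S :: "'i \<Rightarrow> 's measure" and f :: "'i \<Rightarrow> (nat \<Rightarrow> 'a) \<Rightarrow> 's"
  assumes "prob_space P"
    and "countable I"
    and "\<And>i. i \<in> I \<Longrightarrow> 1 \<le> m i"
    and "\<And>i. i \<in> I \<Longrightarrow> borel_isomorphic_space (S i)"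
    and "\<And>i. i \<in> I \<Longrightarrow> f i \<in> completion (power_measure P (m i)) \<rightarrow>\<^sub>M S i"
  shows "\<exists>g :: 'i \<Rightarrow> (nat \<Rightarrow> real) \<Rightarrow> 's.
     (\<forall>i\<in>I. g i \<in> power_measure unit_lebesgue (m i) \<rightarrow>\<^sub>M S i) \<and>
     canonical_law I m S f P = canonical_law I m S g unit_lebesgue \<and>
     (\<forall>(M :: 'w measure) X (N :: 'v measure) Y.
        iid_sequence M P X \<and> iid_sequence N unit_lebesgue Y \<longrightarrow>
        joint_law I m S f M X = joint_law I m S g N Y) \<and>
     ((\<forall>i\<in>I. symmetric_fun P (m i) (f i)) \<longrightarrow>
      (\<forall>i\<in>I. symmetric_fun unit_lebesgue (m i) (g i)))"
proof -
  note P = assms(1) and f = assms(5)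
  obtain \<phi> :: "'a \<Rightarrow> real" and k :: "'i \<Rightarrow> (nat \<Rightarrow> real) \<Rightarrow> 's" where \<phi>: "\<phi> \<in> borel_measurable P"
    and props: "\<forall>i\<in>I. k i \<in> power_measure borel (m i) \<rightarrow>\<^sub>M S i"
      "\<forall>i\<in>I. AE x in power_measure P (m i). f i x = k i (map_coords (coords (m i)) \<phi> x)"
      "\<forall>i\<in>I. symmetric_fun P (m i) (f i) \<longrightarrow> symmetric_fun borel (m i) (k i)"
    by (rule common_real_factor[OF P assms(2,4) f])
  note k = props(1)[rule_format] and fk = props(2)[rule_format] and sym = props(3)[rule_format]
  obtain \<psi> :: "real \<Rightarrow> real" where \<psi>: "\<psi> \<in> borel_measurable unit_lebesgue"
    and \<psi>\<phi>: "distr unit_lebesgue borel \<psi> = distr P borel \<phi>"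
    using ex_unit_lebesgue_pushforward[OF prob_space.prob_space_distr[OF P \<phi>]] by auto
  define g where "g i x = k i (map_coords (coords (m i)) \<psi> x)" for i x
  have g: "g i \<in> power_measure unit_lebesgue (m i) \<rightarrow>\<^sub>M S i" if "i \<in> I" for i
    unfolding g_def using measurable_map_coords[OF \<psi>] k[OF that] by (rule measurable_compose)
  note g' = measurable_completion[OF g]
  have "canonical_law I m S f P = canonical_law I m S k (distr P borel \<phi>)"
    by (rule canonical_law_transport[OF P \<phi> f k fk])
  also have "\<dots> = canonical_law I m S g unit_lebesgue"
    unfolding \<psi>\<phi>[symmetric]
    by (rule canonical_law_transport[OF prob_space_unit_lebesgue \<psi> g' k, symmetric]) (simp_all add: g_def)
  finally have canonical: "canonical_law I m S f P = canonical_law I m S g unit_lebesgue" .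
  have joint: "joint_law I m S f M X = joint_law I m S g N Y"
    if "iid_sequence M P X" "iid_sequence N unit_lebesgue Y"
    for M :: "'w measure" and X and N :: "'v measure" and Y
    using joint_law_eq_canonical_law[where f=f and S=S and m=m and I=I, OF that(1) P f]
      joint_law_eq_canonical_law[where f=g and S=S and m=m and I=I, OF that(2) prob_space_unit_lebesgue g'] canonical
    by simp
  have "symmetric_fun unit_lebesgue (m i) (g i)" if i: "i \<in> I" and "symmetric_fun P (m i) (f i)" for i
    unfolding symmetric_fun_def
  proof (intro ballI allI impI)
    fix x and \<pi> :: "nat \<Rightarrow> nat"
    assume x: "x \<in> space (power_measure unit_lebesgue (m i))" and \<pi>: "\<pi> permutes coords (m i)"
    have "map_coords (coords (m i)) \<psi> x \<in> space (power_measure borel (m i))"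
      using x \<psi> by (rule map_coords_space)
    then show "g i (permute_coords (coords (m i)) \<pi> x) = g i x"
      unfolding g_def map_coords_permute_coords[OF \<pi>] using \<pi> by (rule symmetric_funD[OF sym[OF that]])
  qed
  with g canonical joint show ?thesis by blast
qed

end
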